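(* Let $X$ be a Hilbert space and let a group $\mathbb{G}$ act linearly and continuously on $X$ such that $\langle\phi x,\phi y\rangle=\langle x,y\rangle$ for all $\phi\in\mathbb{G}$ and $x,y\in X$. Then for each $x\in X$, the orbitope $\Pi(x)$ is weakly compact and orthogonal to $X_{\mathbb{G}}$. All $y\in\Pi(x)$ satisfy $\bar{y}=\bar{x}$ and $\|y\|\leq\|x\|$. If $\mathbb{G}$ is (nice and) amenable, then $\Pi(x)\cap X_{\mathbb{G}}=\{\bar{x}\}$.
   Context: $\mathbb{G}$ is a topological group; an action is continuous if it is jointly continuous. $X_{\mathbb{G}}:=\{x\in X\,|\,\phi x=x\text{ for all }\phi\in\mathbb{G}\}$ is the subspace of $\mathbb{G}$-invariant elements, and $\bar{x}$ denotes the orthogonal projection of $x$ onto $X_{\mathbb{G}}$. The orbitope $\Pi(x)$ is the closed convex hull of the orbit $\{\phi x\,|\,\phi\in\mathbb{G}\}$ (the norm and weak closed convex hulls coincide). That $\Pi(x)$ is orthogonal to $X_{\mathbb{G}}$ means that the shifted orbitope $\Pi(x)-x$ is contained in the orthocomplement $X_{\mathbb{G}}^\perp$. A topological group is nice if its topology is locally compact and Polish. A nice group, with Haar measure $|\cdot|$, is amenable if it contains a Følner sequence, i.e. a sequence of compact sets $\mathbf{A}_n\subset\mathbb{G}$ with $|\mathbf{A}_n\cap K\mathbf{A}_n|/|\mathbf{A}_n|\to1$ for all compact $K\subset\mathbb{G}$. *)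

theory Defs
  imports "HOL-Analysis.Analysis" "HOL-Algebra.Group_Action"
begin

section \<open>Topological groups and amenability\<close>

locale topological_group = group G for G (structure) +
  fixes T :: "'a topology"
  assumes topspace_eq: "topspace T = carrier G"
    and continuous_mult: "continuous_map (prod_topology T T) T (\<lambda>(g, h). g \<otimes> h)"
    and continuous_inv: "continuous_map T T (\<lambda>g. inv g)"

definition polish_topology :: "'a topology \<Rightarrow> bool"
  where "polish_topology T \<longleftrightarrow> completely_metrizable_space T \<and> separable_space T"

definition nice_group :: "('a, 'b) monoid_scheme \<Rightarrow> 'a topology \<Rightarrow> bool"
  where "nice_group G T \<longleftrightarrow>
    topological_group G T \<and> locally_compact_space T \<and> polish_topology T"

text \<open>
  Left Haar measures on the Borel sets. Inner and outer regularity are not listed: a Borel measure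
  that is finite on compact sets is automatically regular on a locally compact Polish space,
  which is the only setting in which the definition is used.
\<close>

definition haar_measure :: "('a, 'b) monoid_scheme \<Rightarrow> 'a topology \<Rightarrow> 'a measure \<Rightarrow> bool"
  where "haar_measure G T \<mu> \<longleftrightarrow>
    space \<mu> = topspace T \<and>
    sets \<mu> = sigma_sets (topspace T) {U. openin T U} \<and>
    (\<forall>g\<in>carrier G. \<forall>B\<in>sets \<mu>. emeasure \<mu> (g <#\<^bsub>G\<^esub> B) = emeasure \<mu> B) \<and>
    (\<forall>K. compactin T K \<longrightarrow> emeasure \<mu> K < \<infinity>) \<and>
    (\<forall>U. openin T U \<and> U \<noteq> {} \<longrightarrow> 0 < emeasure \<mu> U)"

text \<open>
  The set \<open>K\<close> has to be nonempty, since the quotient is \<open>0\<close> for \<open>K = {}\<close>. As division by \<open>0\<close>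
  yields \<open>0\<close>, convergence to \<open>1\<close> forces \<open>A n\<close> to have positive measure for all large \<open>n\<close>.
\<close>

definition folner_sequence ::
  "('a, 'b) monoid_scheme \<Rightarrow> 'a topology \<Rightarrow> 'a measure \<Rightarrow> (nat \<Rightarrow> 'a set) \<Rightarrow> bool"
  where "folner_sequence G T \<mu> A \<longleftrightarrow>
    (\<forall>n. compactin T (A n)) \<and>
    (\<forall>K. compactin T K \<and> K \<noteq> {} \<longrightarrow>
      (\<lambda>n. measure \<mu> (A n \<inter> (K <#>\<^bsub>G\<^esub> A n)) / measure \<mu> (A n)) \<longlonglongrightarrow> 1)"

definition amenable_group :: "('a, 'b) monoid_scheme \<Rightarrow> 'a topology \<Rightarrow> bool"
  where "amenable_group G T \<longleftrightarrow>
    nice_group G T \<and> (\<exists>\<mu> A. haar_measure G T \<mu> \<and> folner_sequence G T \<mu> A)"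


section \<open>Hilbert spaces\<close>

text \<open>The coarsest topology that makes every bounded linear functional continuous.\<close>

definition weak_topology :: "'x::real_normed_vector topology"
  where "weak_topology =
    topology_generated_by {f -` U | (f :: 'x \<Rightarrow> real) U. bounded_linear f \<and> open U}"

text \<open>
  The unique point of \<open>S\<close> whose difference from \<open>x\<close> is orthogonal to \<open>S\<close>. It exists if \<open>S\<close> is a
  closed subspace of a Hilbert space. (The library's \<open>closest_point\<close> requires a Heine-Borel space.)
\<close>

definition orthogonal_projection :: "'x::real_inner set \<Rightarrow> 'x \<Rightarrow> 'x"
  where "orthogonal_projection S x = (THE p. p \<in> S \<and> x - p \<in> orthogonal_comp S)"

lemma orthogonal_projection_eqI:
  assumes "subspace S" "p \<in> S" "x - p \<in> orthogonal_comp S"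
  shows "orthogonal_projection S x = p"
  unfolding orthogonal_projection_def
proof (rule the_equality)
  fix q assume q: "q \<in> S \<and> x - q \<in> orthogonal_comp S"
  have "(x - p) - (x - q) \<in> orthogonal_comp S"
    using q assms(3) by (blast intro: subspace_diff subspace_orthogonal_comp)
  then have "q - p \<in> orthogonal_comp S"
    by simp
  moreover have "q - p \<in> S"
    using q assms by (blast intro: subspace_diff)
  ultimately have "(q - p) \<bullet> (q - p) = 0"
    by (auto simp: orthogonal_comp_def orthogonal_def)
  then show "q = p"
    by simp
qed (use assms in blast)


section \<open>Invariant elements and orbitopes\<close>

definition invariant_elements :: "('a, 'b) monoid_scheme \<Rightarrow> ('a \<Rightarrow> 'x \<Rightarrow> 'x) \<Rightarrow> 'x set"
  where "invariant_elements G \<phi> = {x. \<forall>g\<in>carrier G. \<phi> g x = x}"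

definition orbitope ::
  "('a, 'b) monoid_scheme \<Rightarrow> ('a \<Rightarrow> 'x \<Rightarrow> 'x) \<Rightarrow> 'x::real_normed_vector \<Rightarrow> 'x set"
  where "orbitope G \<phi> x = closure (convex hull (orbit G \<phi> x))"

end

theory Submission
  imports Defs
begin

text \<open>
  Everything rests on one consequence of the parallelogram law: points of a convex set that almost
  minimise the norm are close to each other. By completeness, a family of closed convex sets has
  a common point in a bounded closed convex set \<open>C\<close> as soon as finitely many of its members always do
  (\<open>closed_convex_fip\<close>): the almost minimal points of the finite intersections form closed sets of
  arbitrarily small diameter.

  Applied to half-spaces, this gives weak compactness (\<open>compactin_weak_topology_convex\<close>). Open
  half-spaces form a subbase of the weak topology, so by Alexander's theorem only covers of \<open>C\<close> by open
  half-spaces matter, and the complements of these are closed and convex.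

  Applied to balls around \<open>0\<close>, it gives a unique point of least norm in every nonempty closed
  convex set. The orbitope is mapped into itself by the group and the group preserves norms, so the
  group fixes the point of least norm of the orbitope (\<open>orbitope_contains_invariant\<close>). For an
  amenable group it is the limit of the averages of the orbit over a Foelner sequence.

  The remaining claims are closed convex conditions on \<open>y\<close>, so they pass from the orbit of \<open>x\<close> to the
  orbitope: \<open>norm y \<le> norm x\<close>, and orthogonality of \<open>y - x\<close> to the invariant elements. The latter
  says that \<open>x\<close> and \<open>y\<close> have the same projection, so an invariant point of the orbitope is the
  projection of \<open>x\<close>.
\<close>

section \<open>Intersections of closed convex sets\<close>

lemma infdist_lessD:
  assumes "A \<noteq> {}" "infdist x A < r"
  shows "\<exists>y\<in>A. dist x y < r"
  using cInf_lessD[of "dist x ` A" r] assms by (auto simp: infdist_notempty)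

text \<open>
  This is the parallelogram law
  \<open>\<parallel>a - b\<parallel>\<^sup>2 = 2 \<parallel>a\<parallel>\<^sup>2 + 2 \<parallel>b\<parallel>\<^sup>2 - 4 \<parallel>(a + b) / 2\<parallel>\<^sup>2\<close>, where the midpoint
  lies in \<open>D\<close> by convexity.
\<close>

lemma convex_near_minimal_norm_close:
  fixes D :: "'x::real_inner set"
  assumes "convex D" "a \<in> D" "b \<in> D" "norm a \<le> r" "norm b \<le> r"
  shows "(dist a b)\<^sup>2 \<le> 4 * (r\<^sup>2 - (infdist 0 D)\<^sup>2)"
proof -
  have "midpoint a b \<in> D"
    using assms(1-3) by (meson convex_contains_segment midpoint_in_closed_segment subsetD)
  then have "infdist 0 D \<le> norm (midpoint a b)"
    using infdist_le[of "midpoint a b" D 0] by (simp add: dist_norm)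
  then have "(infdist 0 D)\<^sup>2 \<le> (norm (midpoint a b))\<^sup>2"
    by (simp add: infdist_nonneg power_mono)
  moreover have "(norm a)\<^sup>2 \<le> r\<^sup>2" "(norm b)\<^sup>2 \<le> r\<^sup>2"
    using assms(4,5) by (simp_all add: power_mono)
  moreover have "(dist a b)\<^sup>2 = 2 * (norm a)\<^sup>2 + 2 * (norm b)\<^sup>2 - 4 * (norm (midpoint a b))\<^sup>2"
    by (simp add: dist_norm power2_norm_eq_inner midpoint_def algebra_simps inner_commute)
  ultimately show ?thesis
    by (simp add: algebra_simps)
qed

text \<open>
  The least norm on the finite intersections increases as more sets are intersected, and stays
  bounded since \<open>C\<close> is. Let \<open>s\<close> be its supremum. A finite intersection with least norm close to
  \<open>s\<close> meets a ball around \<open>0\<close> of radius slightly above \<open>s\<close> in a set of small diameter.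
\<close>

lemma closed_convex_fip:
  fixes C :: "'x::{real_inner, complete_space} set"
  assumes C: "closed C" "convex C" "bounded C"
    and F: "\<And>K. K \<in> F \<Longrightarrow> closed K" "\<And>K. K \<in> F \<Longrightarrow> convex K"
    and fip: "\<And>S. finite S \<Longrightarrow> S \<subseteq> F \<Longrightarrow> C \<inter> \<Inter>S \<noteq> {}"
  shows "C \<inter> \<Inter>F \<noteq> {}"
proof -
  define I where "I = {S. finite S \<and> S \<subseteq> F}"
  define D where "D S = C \<inter> \<Inter>S" for S
  define s where "s = (SUP S\<in>I. infdist 0 (D S))"
  define \<C> where "\<C> = {D S \<inter> cball 0 r | S r. S \<in> I \<and> s < r}"
  have \<C>_I: "D S \<inter> cball 0 r \<in> \<C>" if "S \<in> I" "s < r" for S r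
    using that unfolding \<C>_def by blast
  have empty_I: "{} \<in> I"
    by (simp add: I_def)
  have D: "closed (D S)" "convex (D S)" "D S \<noteq> {}" if "S \<in> I" for S
    using that C F fip unfolding D_def I_def
    by (auto intro!: closed_Int closed_Inter convex_Int convex_Inter)
  obtain M where M: "\<And>y. y \<in> C \<Longrightarrow> norm y \<le> M"
    using C(3) by (auto simp: bounded_iff)
  have "infdist 0 (D S) \<le> M" if S: "S \<in> I" for S
  proof -
    obtain y where "y \<in> D S" using D(3)[OF S] by blast
    then show ?thesis
      using M[of y] by (intro infdist_le2[of y]) (auto simp: D_def)
  qed
  then have bdd: "bdd_above ((\<lambda>S. infdist 0 (D S)) ` I)"
    by (auto simp: bdd_above_def)
  have le_s: "infdist 0 (D S) \<le> s" if "S \<in> I" for S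
    unfolding s_def by (rule cSUP_upper[OF that bdd])
  have s0: "0 \<le> s"
    using le_s[OF empty_I] infdist_nonneg order_trans by blast
  have nonempty: "E \<noteq> {}" if "E \<in> \<C>" for E
  proof -
    obtain S r where E: "E = D S \<inter> cball 0 r" "S \<in> I" "s < r"
      using \<open>E \<in> \<C>\<close> by (auto simp: \<C>_def)
    then show ?thesis
      using infdist_lessD[OF D(3)[OF E(2)], of 0 r] le_s[OF E(2)] by auto
  qed
  have small: "\<exists>E a. E \<in> \<C> \<and> E \<subseteq> cball a e" if "0 < e" for e
  proof -
    \<comment> \<open>The radius \<open>s + \<delta>\<close> and least norm above \<open>s - \<delta>\<close> bound the squared diameter by
      \<open>8 * \<delta> * (2 * s + 1)\<close>.\<close>
    define \<delta> where "\<delta> = min 1 (e\<^sup>2 / (8 * (2 * s + 1)))"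
    have \<delta>: "0 < \<delta>" "\<delta> \<le> 1" "\<delta> \<le> e\<^sup>2 / (8 * (2 * s + 1))"
      using \<open>0 < e\<close> s0 by (auto simp: \<delta>_def)
    then have \<delta>_e: "\<delta> * (8 * (2 * s + 1)) \<le> e\<^sup>2"
      using s0 by (simp add: pos_le_divide_eq)
    have "s - \<delta> < s" using \<delta> by simp
    then obtain S where S: "S \<in> I" "s - \<delta> < infdist 0 (D S)"
      unfolding s_def using less_cSUP_iff[OF _ bdd] empty_I by blast
    let ?E = "D S \<inter> cball 0 (s + \<delta>)" and ?d = "infdist 0 (D S)"
    have E: "?E \<in> \<C>"
      using S(1) \<delta>(1) by (intro \<C>_I) auto
    obtain a where a: "a \<in> ?E"
      using nonempty[OF E] by blast
    have "dist a b \<le> e" if "b \<in> ?E" for b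
    proof -
      have "(dist a b)\<^sup>2 \<le> 4 * ((s + \<delta>)\<^sup>2 - ?d\<^sup>2)"
        using a that D(2)[OF S(1)] by (intro convex_near_minimal_norm_close) auto
      also have "\<dots> = 4 * ((s + \<delta> - ?d) * (s + \<delta> + ?d))"
        by (simp add: power2_eq_square algebra_simps)
      also have "\<dots> \<le> 4 * ((2 * \<delta>) * (2 * s + 1))"
        using S(2) le_s[OF S(1)] \<delta> s0 infdist_nonneg[of 0 "D S"]
        by (intro mult_left_mono mult_mono) auto
      also have "\<dots> \<le> e\<^sup>2"
        using \<delta>_e by (simp add: algebra_simps)
      finally show ?thesis
        using \<open>0 < e\<close> by (intro power2_le_imp_le[of "dist a b" e]) auto
    qed
    then show ?thesis
      using E by (intro exI[of _ ?E] exI[of _ a]) auto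
  qed
  have directed: "\<exists>E\<in>\<C>. E \<subseteq> \<Inter>\<F>" if "finite \<F>" "\<F> \<subseteq> \<C>" for \<F>
    using that
  proof (induction \<F> rule: finite_induct)
    case empty
    have "D {} \<inter> cball 0 (s + 1) \<in> \<C>"
      using empty_I by (intro \<C>_I) auto
    then show ?case by auto
  next
    case (insert E1 \<F>)
    then obtain E2 where "E2 \<in> \<C>" and E2_sub: "E2 \<subseteq> \<Inter>\<F>"
      by auto
    then obtain S2 r2 where E2: "E2 = D S2 \<inter> cball 0 r2" "S2 \<in> I" "s < r2"
      by (auto simp: \<C>_def)
    obtain S1 r1 where E1: "E1 = D S1 \<inter> cball 0 r1" "S1 \<in> I" "s < r1"
      using insert.prems by (auto simp: \<C>_def)
    have "D (S1 \<union> S2) \<inter> cball 0 (min r1 r2) \<in> \<C>"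
      using E1(2,3) E2(2,3) by (intro \<C>_I) (auto simp: I_def)
    moreover have "D (S1 \<union> S2) \<inter> cball 0 (min r1 r2) \<subseteq> E1 \<inter> E2"
      by (auto simp: E1(1) E2(1) D_def)
    ultimately show ?case
      using E2_sub by (intro bexI[of _ "D (S1 \<union> S2) \<inter> cball 0 (min r1 r2)"]) auto
  qed
  have closed: "closed E" if "E \<in> \<C>" for E
    using that D(1) by (auto simp: \<C>_def)
  have "Met_TC.mcomplete TYPE('x)"
    by (simp add: complete_UNIV)
  moreover have "\<Inter>\<F> \<noteq> {}" if "finite \<F>" "\<F> \<subseteq> \<C>" for \<F>
    using directed[OF that] nonempty by blast
  ultimately have "\<Inter>\<C> \<noteq> {}"
    using closed small unfolding Met_TC.mcomplete_fip by simp
  then obtain p where p: "p \<in> \<Inter>\<C>"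
    by blast
  have "p \<in> D S" if "S \<in> I" for S
  proof -
    have "D S \<inter> cball 0 (s + 1) \<in> \<C>"
      using that by (intro \<C>_I) auto
    then show ?thesis using p by blast
  qed
  from this[OF empty_I] this[of "{K}" for K] have "p \<in> C \<inter> \<Inter>F"
    by (auto simp: D_def I_def)
  then show ?thesis
    by blast
qed

text \<open>
  For existence, intersect \<open>C\<close> with the balls whose radii exceed the infimum of the norm. Two
  points of least norm coincide since \<open>convex_near_minimal_norm_close\<close> bounds their distance by \<open>0\<close>.
\<close>

lemma closed_convex_least_norm:
  fixes C :: "'x::{real_inner, complete_space} set"
  assumes "closed C" "convex C" "C \<noteq> {}"
  shows "\<exists>!p. p \<in> C \<and> (\<forall>y\<in>C. norm p \<le> norm y)"
proof (rule ex_ex1I)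
  let ?d = "infdist 0 C"
  let ?F = "cball (0::'x) ` {?d<..}"
  have meets: "\<exists>y\<in>C. norm y < r" if "?d < r" for r
    using infdist_lessD[OF assms(3) that] by simp
  have "(C \<inter> cball 0 (?d + 1)) \<inter> \<Inter>?F \<noteq> {}"
  proof (rule closed_convex_fip)
    fix S assume S: "finite S" "S \<subseteq> ?F"
    obtain R where R: "finite R" "R \<subseteq> {?d<..}" "S = cball 0 ` R"
      using finite_subset_image[OF S] by blast
    define r where "r = Min (insert (?d + 1) R)"
    have "?d < r"
      using R(1,2) by (auto simp: r_def)
    then obtain y where y: "y \<in> C" "norm y < r"
      using meets by blast
    have "r \<le> t" if "t \<in> insert (?d + 1) R" for t
      unfolding r_def using R(1) that by (intro Min_le) auto
    then have "y \<in> (C \<inter> cball 0 (?d + 1)) \<inter> \<Inter>S"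
      using y R(3) by (auto intro: less_imp_le less_le_trans)
    then show "(C \<inter> cball 0 (?d + 1)) \<inter> \<Inter>S \<noteq> {}"
      by blast
  qed (use assms in \<open>auto intro: convex_Int bounded_subset[OF bounded_cball]\<close>)
  then obtain p where p: "p \<in> C" "p \<in> \<Inter>?F"
    by blast
  have "norm p \<le> ?d"
    by (rule dense_ge) (use p(2) in auto)
  moreover have "?d \<le> norm y" if "y \<in> C" for y
    using infdist_le[OF that, of 0] by simp
  ultimately show "\<exists>p. p \<in> C \<and> (\<forall>y\<in>C. norm p \<le> norm y)"
    using p(1) order_trans by blast
next
  fix p q
  assume p: "p \<in> C \<and> (\<forall>y\<in>C. norm p \<le> norm y)" and q: "q \<in> C \<and> (\<forall>y\<in>C. norm q \<le> norm y)"
  have "norm p \<le> infdist 0 C"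
    using p assms(3) by (auto simp: infdist_notempty intro!: cINF_greatest)
  moreover have "norm q \<le> norm p"
    using p q by blast
  ultimately have "(dist p q)\<^sup>2 \<le> 4 * ((infdist 0 C)\<^sup>2 - (infdist 0 C)\<^sup>2)"
    using p q assms(2) by (intro convex_near_minimal_norm_close) auto
  then show "p = q"
    by simp
qed

section \<open>Weak compactness\<close>

text \<open>
  Let \<open>Y\<close> be the topology on \<open>C\<close> generated by the traces of open half-spaces. It is compact by
  Alexander's theorem, so it is enough that the inclusion of \<open>Y\<close> into the weak topology is
  continuous, that is, that functionals are continuous on \<open>Y\<close>.
\<close>

lemma compactin_weak_topology_convex:
  fixes C :: "'x::{real_inner, complete_space} set"
  assumes C: "closed C" "convex C" "bounded C"
  shows "compactin weak_topology C"
proof -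
  define \<B> where "\<B> = {{y. a < f y} | (f :: 'x \<Rightarrow> real) a. bounded_linear f}"
  define Y where "Y = topology (arbitrary union_of (finite intersection_of (\<lambda>B. B \<in> \<B>) relative_to C))"
  have topspace_Y: "topspace Y = C"
    unfolding Y_def by (rule topspace_subbase)
  have "compact_space Y"
  proof (rule Alexander_subbase_alt[OF _ _ Y_def[symmetric]])
    have "UNIV \<in> \<B>"
      unfolding \<B>_def using bounded_linear_zero by (intro CollectI exI[of _ "\<lambda>_. 0"] exI[of _ "-1"]) auto
    then show "C \<subseteq> \<Union>\<B>"
      by blast
  next
    fix \<U> assume \<U>: "\<U> \<subseteq> \<B>" "C \<subseteq> \<Union>\<U>"
    show "\<exists>\<V>. finite \<V> \<and> \<V> \<subseteq> \<U> \<and> C \<subseteq> \<Union>\<V>"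
    proof (rule ccontr)
      assume no_finite: "\<nexists>\<V>. finite \<V> \<and> \<V> \<subseteq> \<U> \<and> C \<subseteq> \<Union>\<V>"
      have "C \<inter> \<Inter>(uminus ` \<U>) \<noteq> {}"
      proof (rule closed_convex_fip[OF C])
        fix K assume "K \<in> uminus ` \<U>"
        then obtain f a where f: "bounded_linear (f :: 'x \<Rightarrow> real)" and K: "K = - {y. a < f y}"
          using \<U>(1) unfolding \<B>_def by fast
        have K_eq: "K = f -` {..a}"
          unfolding K by auto
        show "closed K"
          unfolding K_eq using continuous_closed_vimage[OF closed_atMost linear_continuous_at[OF f]] .
        show "convex K"
          unfolding K_eq using convex_linear_vimage[OF bounded_linear.linear[OF f]] by simp
      next
        fix S assume S: "finite S" "S \<subseteq> uminus ` \<U>"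
        obtain \<V> where "finite \<V>" "\<V> \<subseteq> \<U>" "S = uminus ` \<V>"
          using finite_subset_image[OF S] by blast
        then obtain y where "y \<in> C" "y \<notin> \<Union>\<V>"
          using no_finite by blast
        then have "y \<in> C \<inter> \<Inter>S"
          using \<open>S = uminus ` \<V>\<close> by simp
        then show "C \<inter> \<Inter>S \<noteq> {}"
          by blast
      qed
      then show False
        using \<U>(2) by auto
    qed
  qed
  moreover have "continuous_map Y weak_topology id"
    unfolding weak_topology_def
  proof (rule continuous_on_generated_topo)
    fix W assume "W \<in> {f -` U | (f :: 'x \<Rightarrow> real) U. bounded_linear f \<and> open U}"
    then obtain f U where W: "W = f -` U" and f: "bounded_linear (f :: 'x \<Rightarrow> real)" and "open U"
      by blast
    have half_space: "openin Y {y \<in> C. a < g y}" if "bounded_linear (g :: 'x \<Rightarrow> real)" for g a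
    proof -
      have "{y. a < g y} \<in> \<B>"
        using that by (auto simp: \<B>_def)
      then have "openin Y (C \<inter> {y. a < g y})"
        unfolding Y_def openin_subbase
        by (intro arbitrary_union_of_inc relative_to_inc finite_intersection_of_inc)
      then show ?thesis
        by (simp add: Collect_conj_eq)
    qed
    have "openin Y {y \<in> C. f y < a}" for a
      using half_space[OF bounded_linear_minus[OF f], of "- a"] by simp
    then have "continuous_map Y euclideanreal f"
      using half_space[OF f]
      by (simp add: continuous_map_upper_lower_semicontinuous_lt topspace_Y)
    then have "openin Y {y \<in> topspace Y. f y \<in> U}"
      using \<open>open U\<close> by (intro openin_continuous_map_preimage) auto
    then show "openin Y (id -` W \<inter> topspace Y)"
      by (simp add: W vimage_def Collect_conj_eq Int_commute)
  next
    have "(\<lambda>_. 0) -` UNIV \<in> {f -` U | (f :: 'x \<Rightarrow> real) U. bounded_linear f \<and> open U}"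
      using bounded_linear_zero by blast
    then show "id ` topspace Y \<subseteq> \<Union>{f -` U | (f :: 'x \<Rightarrow> real) U. bounded_linear f \<and> open U}"
      by auto
  qed
  ultimately have "compactin weak_topology (id ` C)"
    by (metis image_compactin compact_space_def topspace_Y)
  then show ?thesis
    by simp
qed

section \<open>Orbitopes of isometric linear actions\<close>

lemma orbitope_subset:
  assumes "orbit G \<phi> x \<subseteq> S" "closed S" "convex S"
  shows "orbitope G \<phi> x \<subseteq> S"
  unfolding orbitope_def using assms by (simp add: closure_minimal hull_minimal)

lemma orbit_subset_orbitope: "orbit G \<phi> x \<subseteq> orbitope G \<phi> x"
  unfolding orbitope_def by (meson closure_subset hull_subset order_trans)

lemma closed_orbitope: "closed (orbitope G \<phi> x)"
  by (simp add: orbitope_def)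

lemma convex_orbitope: "convex (orbitope G \<phi> x)"
  by (simp add: orbitope_def convex_closure convex_convex_hull)

locale orthogonal_action = group_action G UNIV \<phi>
  for G :: "('a, 'b) monoid_scheme" and \<phi> :: "'a \<Rightarrow> 'x::{real_inner, complete_space} \<Rightarrow> 'x" +
  assumes linear_action: "g \<in> carrier G \<Longrightarrow> linear (\<phi> g)"
    and inner_action: "g \<in> carrier G \<Longrightarrow> \<phi> g y \<bullet> \<phi> g z = y \<bullet> z"
begin

lemma norm_action: "g \<in> carrier G \<Longrightarrow> norm (\<phi> g y) = norm y"
  by (simp add: norm_eq_sqrt_inner inner_action)

lemma self_in_orbitope: "x \<in> orbitope G \<phi> x"
  using orbit_refl[of x] orbit_subset_orbitope by blast

lemma norm_orbitope:
  assumes "y \<in> orbitope G \<phi> x"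
  shows "norm y \<le> norm x"
proof -
  have "orbitope G \<phi> x \<subseteq> cball 0 (norm x)"
    by (rule orbitope_subset) (auto simp: orbit_def norm_action)
  then show ?thesis
    using assms by auto
qed

text \<open>On the orbit, \<open>\<phi> g x \<bullet> z = \<phi> g x \<bullet> \<phi> g z = x \<bullet> z\<close> for invariant \<open>z\<close>.\<close>

lemma orbitope_orthogonal:
  assumes "y \<in> orbitope G \<phi> x"
  shows "y - x \<in> orthogonal_comp (invariant_elements G \<phi>)"
proof -
  have "z \<bullet> (y - x) = 0" if "z \<in> invariant_elements G \<phi>" for z
  proof -
    have "z \<bullet> \<phi> g x = z \<bullet> x" if "g \<in> carrier G" for g
      using inner_action[OF that, of z x] that \<open>z \<in> invariant_elements G \<phi>\<close>
      by (simp add: invariant_elements_def)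
    then have "orbitope G \<phi> x \<subseteq> {y. z \<bullet> y = z \<bullet> x}"
      by (intro orbitope_subset closed_hyperplane convex_hyperplane) (auto simp: orbit_def)
    then show ?thesis
      using assms by (auto simp: inner_diff_right)
  qed
  then show ?thesis
    by (simp add: orthogonal_comp_def orthogonal_def)
qed

lemma subspace_invariant_elements: "subspace (invariant_elements G \<phi>)"
  unfolding subspace_def invariant_elements_def
  by (auto simp: linear_action linear_0 linear_add linear_scale)

text \<open>
  The two points differ by an element of the orthocomplement, so the conditions that
  characterise their projections are equivalent.
\<close>

lemma orthogonal_projection_orbitope:
  assumes "y \<in> orbitope G \<phi> x"
  shows "orthogonal_projection (invariant_elements G \<phi>) y =
    orthogonal_projection (invariant_elements G \<phi>) x"
proof -
  let ?P = "orthogonal_comp (invariant_elements G \<phi>)"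
  have "y - p \<in> ?P \<longleftrightarrow> x - p \<in> ?P" for p
    using subspace_add[OF subspace_orthogonal_comp orbitope_orthogonal[OF assms], of "x - p"]
      subspace_diff[OF subspace_orthogonal_comp _ orbitope_orthogonal[OF assms], of "y - p"]
    by auto
  then show ?thesis
    by (simp add: orthogonal_projection_def)
qed

lemma invariant_in_orbitope_eq_projection:
  assumes "p \<in> orbitope G \<phi> x" "p \<in> invariant_elements G \<phi>"
  shows "orthogonal_projection (invariant_elements G \<phi>) x = p"
proof (rule orthogonal_projection_eqI[OF subspace_invariant_elements assms(2)])
  show "x - p \<in> orthogonal_comp (invariant_elements G \<phi>)"
    using subspace_neg[OF subspace_orthogonal_comp orbitope_orthogonal[OF assms(1)]] by simp
qed

lemma action_orbitope:
  assumes g: "g \<in> carrier G" and y: "y \<in> orbitope G \<phi> x"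
  shows "\<phi> g y \<in> orbitope G \<phi> x"
proof -
  have "bounded_linear (\<phi> g)"
    using linear_action[OF g] norm_action[OF g]
    by (intro bounded_linear_intro[where K = 1]) (auto simp: linear_add linear_scale)
  then have "closed (\<phi> g -` orbitope G \<phi> x)"
    using continuous_closed_vimage[OF closed_orbitope linear_continuous_at] by blast
  moreover have "convex (\<phi> g -` orbitope G \<phi> x)"
    using convex_linear_vimage[OF linear_action[OF g] convex_orbitope] .
  moreover have "orbit G \<phi> x \<subseteq> \<phi> g -` orbitope G \<phi> x"
  proof
    fix z assume "z \<in> orbit G \<phi> x"
    moreover have "\<phi> g z \<in> orbit G \<phi> z"
      using g by (auto simp: orbit_def)
    ultimately have "\<phi> g z \<in> orbit G \<phi> x"
      by (rule orbit_trans[rotated 3]) auto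
    then show "z \<in> \<phi> g -` orbitope G \<phi> x"
      using orbit_subset_orbitope by blast
  qed
  ultimately show ?thesis
    using orbitope_subset y by blast
qed

text \<open>
  The group permutes the points of least norm of the orbitope, and there is only one such point.
\<close>

lemma orbitope_contains_invariant: "orbitope G \<phi> x \<inter> invariant_elements G \<phi> \<noteq> {}"
proof -
  let ?least = "\<lambda>p. p \<in> orbitope G \<phi> x \<and> (\<forall>y\<in>orbitope G \<phi> x. norm p \<le> norm y)"
  have unique: "\<exists>!p. ?least p"
    using closed_convex_least_norm[OF closed_orbitope convex_orbitope] self_in_orbitope by blast
  then obtain p where p: "?least p"
    by blast
  have "?least (\<phi> g p)" if "g \<in> carrier G" for g
    using p that by (simp add: action_orbitope norm_action)
  then have "\<phi> g p = p" if "g \<in> carrier G" for g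
    using unique p that by blast
  then show ?thesis
    using p by (auto simp: invariant_elements_def)
qed

lemma orbitope_inter_invariant:
  "orbitope G \<phi> x \<inter> invariant_elements G \<phi> =
    {orthogonal_projection (invariant_elements G \<phi>) x}"
  using orbitope_contains_invariant[of x] invariant_in_orbitope_eq_projection[of _ x] by blast

lemma compactin_weak_topology_orbitope: "compactin weak_topology (orbitope G \<phi> x)"
  using norm_orbitope[of _ x]
  by (intro compactin_weak_topology_convex closed_orbitope convex_orbitope)
    (auto simp: bounded_iff)

end

theorem proposition11:
  fixes G :: "('a, 'b) monoid_scheme"
    and T :: "'a topology"
    and \<phi> :: "'a \<Rightarrow> 'x::{real_inner, complete_space} \<Rightarrow> 'x"
  assumes "topological_group G T"
    and "group_action G UNIV \<phi>"
    and "\<And>g. g \<in> carrier G \<Longrightarrow> linear (\<phi> g)"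
    and "continuous_map (prod_topology T euclidean) euclidean (\<lambda>(g, x). \<phi> g x)"
    and "\<And>g x y. g \<in> carrier G \<Longrightarrow> \<phi> g x \<bullet> \<phi> g y = x \<bullet> y"
  shows "(\<forall>x. compactin weak_topology (orbitope G \<phi> x) \<and>
            (\<lambda>y. y - x) ` orbitope G \<phi> x \<subseteq> orthogonal_comp (invariant_elements G \<phi>) \<and>
            (\<forall>y\<in>orbitope G \<phi> x.
               orthogonal_projection (invariant_elements G \<phi>) y =
                 orthogonal_projection (invariant_elements G \<phi>) x \<and>
               norm y \<le> norm x)) \<and>
         (amenable_group G T \<longrightarrow>
            (\<forall>x. orbitope G \<phi> x \<inter> invariant_elements G \<phi> =
               {orthogonal_projection (invariant_elements G \<phi>) x}))"
proof -
  interpret orthogonal_action G \<phi>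
    using assms(2,3,5) by (simp add: orthogonal_action_def orthogonal_action_axioms_def)
  show ?thesis
    using compactin_weak_topology_orbitope orbitope_orthogonal orthogonal_projection_orbitope
      norm_orbitope orbitope_inter_invariant
    by (simp add: image_subset_iff)
qed

end
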